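(* Suppose that $A,B,X,Y\in \mathbb{C}^{n\times n}$ are all Hermitian positive semi-definite. Let $E=(A+X):(B+Y)-A:B$. For $\alpha>0,\beta>0$ put $Z_{\alpha,\beta}=\frac{X}{\alpha}\vee\frac{Y}{\beta}$; it satisfies $Z_{\alpha,\beta}=\frac{1}{\alpha}\left(X\vee \frac{Y}{t}\right)$ for $t=\frac{\beta}{\alpha}$. For $t>0$ let $$f(t)=\frac{1}{1+t}\left[\Vert (A+B)^\dagger (tA-B)\Vert^2+t\right]\cdot \left\Vert X\vee \frac{Y}{t}\right\Vert.$$ Then $$\Vert E\Vert \le \inf_{\alpha>0,\beta>0}\left[\frac{\Vert (A+B)^\dagger (\beta A-\alpha B)\Vert^2\cdot \Vert A+B\Vert}{(\alpha+\beta)\Vert A+B\Vert+(\alpha+\beta)^2\left\Vert Z_{\alpha,\beta}\right\Vert}+\frac{\alpha\beta}{\alpha+\beta}\right]\big\Vert Z_{\alpha,\beta}\big\Vert$$ $$\le\inf_{\alpha>0,\beta>0}\frac{1}{\alpha+\beta}\Big[\Vert (A+B)^\dagger (\beta A-\alpha B)\Vert^2+\alpha\beta\Big]\big\Vert Z_{\alpha,\beta}\big\Vert=\inf_{t>0}f(t),$$ where the first fraction in the first bracket is read as $0$ if its denominator is $0$.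
   Context: $\mathbb{C}^{n\times n}$ is the set of $n\times n$ complex matrices; $\Vert M\Vert$ is the 2-norm (spectral/operator norm) of $M$. $M^\dagger$ denotes the Moore-Penrose inverse of $M$, i.e. the unique matrix satisfying $MM^\dagger M=M$, $M^\dagger MM^\dagger=M^\dagger$, $(MM^\dagger)^*=MM^\dagger$, $(M^\dagger M)^*=M^\dagger M$. For a Hermitian positive semi-definite $M$, $M^{\frac12}$ is its positive semi-definite square root. The parallel sum of Hermitian positive semi-definite matrices $P,Q\in\mathbb{C}^{n\times n}$ is $P:Q=P(P+Q)^\dagger Q$. For Hermitian positive semi-definite $P,Q\in\mathbb{C}^{n\times n}$ the matrix $P\vee Q$ is defined by $$P\vee Q=\frac{P+Q}{2}+(P+Q)^{\frac12}\, W_{P,Q}^{\frac12}\, (P+Q)^{\frac12},\qquad W_{P,Q}=\Big[(P+Q)^\dagger\Big]^{\frac12}\Big[\frac{P+Q}{4}-P:Q\Big]\Big[(P+Q)^\dagger\Big]^{\frac12},$$ where $W_{P,Q}$ is positive semi-definite (because $P+Q-4(P:Q)$ is positive semi-definite). *)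

theory Defs
  imports "HOL-Analysis.Analysis"
begin

text \<open>
  Matrices are of type \<open>complex^'n^'n\<close> for an arbitrary finite index type \<open>'n\<close>.
\<close>

definition ctranspose :: "complex^'n^'m \<Rightarrow> complex^'m^'n" where
  "ctranspose M = (\<chi> i j. cnj (M $ j $ i))"

definition hermitian :: "complex^'n^'n \<Rightarrow> bool" where
  "hermitian M \<longleftrightarrow> ctranspose M = M"

text \<open>
  For Hermitian \<open>M\<close> the number \<open>x\<^sup>* M x\<close> is real, so taking its real part loses nothing.
\<close>

definition psd :: "complex^'n^'n \<Rightarrow> bool" where
  "psd M \<longleftrightarrow> hermitian M \<and> (\<forall>x. 0 \<le> Re (\<Sum>i\<in>UNIV. cnj (x $ i) * (M *v x) $ i))"

text \<open>
  The library's \<open>norm\<close> on \<open>complex^'n^'n\<close> is the Frobenius norm; the spectral norm is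
  the operator norm with respect to the Euclidean norm on \<open>complex^'n\<close>.
\<close>

definition spectral_norm :: "complex^'n^'m \<Rightarrow> real" where
  "spectral_norm M = onorm (\<lambda>x. M *v x)"

definition is_moore_penrose :: "complex^'n^'m \<Rightarrow> complex^'m^'n \<Rightarrow> bool" where
  "is_moore_penrose M N \<longleftrightarrow>
     M ** N ** M = M \<and> N ** M ** N = N \<and>
     ctranspose (M ** N) = M ** N \<and> ctranspose (N ** M) = N ** M"

definition pinv :: "complex^'n^'m \<Rightarrow> complex^'m^'n" where
  "pinv M = (THE N. is_moore_penrose M N)"

text \<open>Only meaningful for positive semi-definite arguments.\<close>

definition psd_sqrt :: "complex^'n^'n \<Rightarrow> complex^'n^'n" where
  "psd_sqrt M = (THE R. psd R \<and> R ** R = M)"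

definition parallel_sum :: "complex^'n^'n \<Rightarrow> complex^'n^'n \<Rightarrow> complex^'n^'n" where
  "parallel_sum P Q = P ** pinv (P + Q) ** Q"

definition W_mat :: "complex^'n^'n \<Rightarrow> complex^'n^'n \<Rightarrow> complex^'n^'n" where
  "W_mat P Q =
     psd_sqrt (pinv (P + Q)) ** ((P + Q) /\<^sub>R 4 - parallel_sum P Q) ** psd_sqrt (pinv (P + Q))"

definition mat_vee :: "complex^'n^'n \<Rightarrow> complex^'n^'n \<Rightarrow> complex^'n^'n" where
  "mat_vee P Q =
     (P + Q) /\<^sub>R 2 + psd_sqrt (P + Q) ** psd_sqrt (W_mat P Q) ** psd_sqrt (P + Q)"

end

theory Submission
  imports Defs
begin

text \<open>
  Since \<open>Z = X/\<alpha> \<or> Y/\<beta>\<close> dominates \<open>X/\<alpha>\<close> and \<open>Y/\<beta>\<close>, one has \<open>X \<le> \<alpha>zI\<close> and \<open>Y \<le> \<beta>zI\<close> with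
  \<open>z = \<parallel>Z\<parallel>\<close>.  The form of \<open>P : Q\<close> at \<open>x\<close> is the minimum of \<open>y\<^sup>*Py + (x - y)\<^sup>*Q(x - y)\<close> over \<open>y\<close>;
  moving away by \<open>d\<close> from the minimiser \<open>y0 = (A + B)\<^sup>\<dagger>Bx\<close> for \<open>A : B\<close> costs exactly \<open>d\<^sup>*(A + B)d\<close>.
  The form of \<open>E\<close>, which is positive semi-definite, is therefore bounded by testing with a vector
  \<open>y\<close> between \<open>y0\<close> and the minimiser \<open>\<beta>x/(\<alpha> + \<beta>)\<close> for \<open>\<alpha>zI : \<beta>zI\<close>.  On the kernel of \<open>A + B\<close> the
  move towards the latter is free; on the range the optimal proportion gives the first bound.

  Square roots and pseudoinverses are obtained by splitting off eigenvectors one at a time, using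
  only the real inner product of \<open>complex^'n\<close>, which is the real part of the Hermitian one.
\<close>

section \<open>Hermitian and positive semi-definite matrices\<close>

lemma matrix_diff_ldistrib: "A ** (B - C) = A ** B - A ** (C :: 'a::ring_1^'n^'m)"
  by (simp add: vec_eq_iff matrix_matrix_mult_def sum_subtractf[symmetric] right_diff_distrib)

lemma matrix_diff_rdistrib: "(A - B) ** C = A ** C - B ** (C :: 'a::ring_1^'n^'m)"
  by (simp add: vec_eq_iff matrix_matrix_mult_def sum_subtractf[symmetric] left_diff_distrib)

lemma matrix_add_rdistrib: "(A + B) ** C = A ** C + B ** (C :: 'a::semiring_1^'n^'m)"
  by (simp add: vec_eq_iff matrix_matrix_mult_def sum.distrib[symmetric] distrib_right)

lemma matrix_scaleR_left: "(c *\<^sub>R A) ** B = c *\<^sub>R (A ** (B :: 'a::real_algebra_1^'n^'m))"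
  by (simp add: vec_eq_iff matrix_matrix_mult_def scaleR_sum_right)

lemma matrix_scaleR_right: "A ** (c *\<^sub>R B) = c *\<^sub>R (A ** (B :: 'a::real_algebra_1^'n^'m))"
  by (simp add: vec_eq_iff matrix_matrix_mult_def scaleR_sum_right)

lemma matrix_vector_scaleR_left: "(c *\<^sub>R A) *v x = c *\<^sub>R (A *v (x :: 'a::real_algebra_1^'n))"
  by (simp add: vec_eq_iff matrix_vector_mult_def scaleR_sum_right)

lemma matrix_vector_scaleR_right: "A *v (c *\<^sub>R x) = c *\<^sub>R (A *v (x :: 'a::real_algebra_1^'n))"
  by (simp add: vec_eq_iff matrix_vector_mult_def scaleR_sum_right)

lemmas matrix_algebra =
  matrix_add_ldistrib matrix_add_rdistrib matrix_diff_ldistrib matrix_diff_rdistrib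
  matrix_scaleR_left matrix_scaleR_right matrix_mul_assoc

lemmas matrix_vector_algebra =
  matrix_vector_right_distrib matrix_vector_mult_add_rdistrib
  matrix_vector_mult_diff_distrib matrix_vector_mult_diff_rdistrib
  matrix_vector_scaleR_left matrix_vector_scaleR_right matrix_vector_mul_assoc[symmetric]

lemma ctranspose_simps [simp]:
  "ctranspose (A + B) = ctranspose A + ctranspose B"
  "ctranspose (A - B) = ctranspose A - ctranspose B"
  "ctranspose (c *\<^sub>R A) = c *\<^sub>R ctranspose A"
  "ctranspose (mat 1 :: complex^'n^'n) = mat 1"
  by (auto simp: ctranspose_def vec_eq_iff mat_def)

lemma ctranspose_mult: "ctranspose (A ** B) = ctranspose B ** ctranspose A"
  by (simp add: ctranspose_def vec_eq_iff matrix_matrix_mult_def mult.commute)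

lemma hermitian_add: "hermitian A \<Longrightarrow> hermitian B \<Longrightarrow> hermitian (A + B)"
  and hermitian_diff: "hermitian A \<Longrightarrow> hermitian B \<Longrightarrow> hermitian (A - B)"
  and hermitian_scaleR: "hermitian A \<Longrightarrow> hermitian (c *\<^sub>R A)"
  and hermitian_mat_1: "hermitian (mat 1)"
  by (simp_all add: hermitian_def)

lemma hermitian_congruence: "hermitian T \<Longrightarrow> hermitian M \<Longrightarrow> hermitian (T ** M ** T)"
  by (simp add: hermitian_def ctranspose_mult matrix_mul_assoc)

lemma hermitian_square: "hermitian T \<Longrightarrow> hermitian (T ** T)"
  by (simp add: hermitian_def ctranspose_mult)

lemmas hermitian_intros =
  hermitian_add hermitian_diff hermitian_scaleR hermitian_mat_1
  hermitian_congruence hermitian_square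

text \<open>On the complex plane with its real inner product, the adjoint of multiplication by
  \<open>a\<close> is multiplication by \<open>cnj a\<close>; hence the conjugate transpose is also
  the adjoint for the real inner product.\<close>

lemma hermitian_inner:
  assumes "hermitian M"
  shows "x \<bullet> (M *v y) = (M *v x) \<bullet> y"
proof -
  have e: "M $ i $ j = cnj (M $ j $ i)" for i j
    using assms by (auto simp: hermitian_def ctranspose_def vec_eq_iff)
  have "x \<bullet> (M *v y) = (\<Sum>i\<in>UNIV. \<Sum>j\<in>UNIV. x $ i \<bullet> (M $ i $ j * y $ j))"
    by (simp add: inner_vec_def matrix_vector_mult_def inner_sum_right)
  also have "\<dots> = (\<Sum>i\<in>UNIV. \<Sum>j\<in>UNIV. (M $ j $ i * x $ i) \<bullet> y $ j)"
  proof (intro sum.cong refl)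
    fix i j
    show "x $ i \<bullet> (M $ i $ j * y $ j) = (M $ j $ i * x $ i) \<bullet> y $ j"
      unfolding e[of i j] by (simp add: inner_complex_def algebra_simps)
  qed
  also have "\<dots> = (\<Sum>j\<in>UNIV. \<Sum>i\<in>UNIV. (M $ j $ i * x $ i) \<bullet> y $ j)"
    by (rule sum.swap)
  also have "\<dots> = (M *v x) \<bullet> y"
    by (simp add: inner_vec_def matrix_vector_mult_def inner_sum_left)
  finally show ?thesis .
qed

section \<open>Quadratic forms of positive semi-definite matrices\<close>

lemma psd_iff_inner: "psd M \<longleftrightarrow> hermitian M \<and> (\<forall>x. 0 \<le> x \<bullet> (M *v x))"
  by (simp add: psd_def inner_vec_def inner_complex_def)

lemma psd_hermitian: "psd M \<Longrightarrow> hermitian M"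
  by (simp add: psd_def)

lemma psd_inner_nonneg: "psd M \<Longrightarrow> 0 \<le> x \<bullet> (M *v x)"
  by (simp add: psd_iff_inner)

lemma psd_add: "psd A \<Longrightarrow> psd B \<Longrightarrow> psd (A + B)"
  by (simp add: psd_iff_inner hermitian_add matrix_vector_algebra inner_add_right)

lemma psd_scaleR: "psd A \<Longrightarrow> 0 \<le> c \<Longrightarrow> psd (c *\<^sub>R A)"
  by (simp add: psd_iff_inner hermitian_scaleR matrix_vector_algebra)

lemma psd_congruence: "hermitian T \<Longrightarrow> psd M \<Longrightarrow> psd (T ** M ** T)"
  by (simp add: psd_iff_inner hermitian_congruence matrix_vector_algebra hermitian_inner[of T])

lemma psd_square: "hermitian T \<Longrightarrow> psd (T ** T)"
  by (metis hermitian_inner hermitian_square inner_ge_zero matrix_vector_mul_assoc psd_iff_inner)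

text \<open>If \<open>M *v u\<close> were nonzero, a small step from \<open>u\<close> against it
  would make the form negative, since the linear term of the change dominates.\<close>

lemma psd_mult_eq_0:
  assumes M: "psd M" and u: "u \<bullet> (M *v u) = 0"
  shows "M *v u = 0"
proof (rule ccontr)
  assume ne: "M *v u \<noteq> 0"
  define v where "v = M *v u"
  define a where "a = v \<bullet> v"
  define b where "b = v \<bullet> (M *v v)"
  have a: "a > 0" using ne by (simp add: a_def v_def)
  have b: "b \<ge> 0" using M by (simp add: b_def psd_inner_nonneg)
  define t where "t = a / (b + 1)"
  have "0 \<le> (u - t *\<^sub>R v) \<bullet> (M *v (u - t *\<^sub>R v))"
    using M by (rule psd_inner_nonneg)
  also have "\<dots> = - 2 * t * a + t\<^sup>2 * b"
    using u hermitian_inner[OF psd_hermitian[OF M], of u v]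
    by (simp add: matrix_vector_algebra inner_diff_left inner_diff_right a_def b_def
        v_def[symmetric] power2_eq_square algebra_simps)
  also have "\<dots> = - (t\<^sup>2 * (b + 2))"
  proof -
    have "a = t * (b + 1)" using b by (simp add: t_def)
    then show ?thesis by (simp add: power2_eq_square algebra_simps)
  qed
  also have "\<dots> < 0"
    using a b by (simp add: t_def)
  finally show False by simp
qed

text \<open>The form attains its maximum \<open>l\<close> on the compact unit sphere, at
  \<open>u\<close> say. Then \<open>l *\<^sub>R mat 1 - M\<close> is positive semi-definite with
  form zero at \<open>u\<close>, so it annihilates \<open>u\<close>.\<close>

lemma hermitian_max_eigenvector:
  fixes M :: "complex^'n^'n"
  assumes M: "hermitian M"
  obtains u l where "norm u = 1" "M *v u = l *\<^sub>R u" "\<And>x. x \<bullet> (M *v x) \<le> l * (x \<bullet> x)"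
proof -
  have "\<exists>u\<in>sphere 0 1. \<forall>x\<in>sphere 0 1. x \<bullet> (M *v x) \<le> u \<bullet> (M *v u)"
  proof (rule continuous_attains_sup)
    show "compact (sphere (0 :: complex^'n) 1)" by simp
    obtain b :: "complex^'n" where "b \<in> Basis" using nonempty_Basis by blast
    then have "b \<in> sphere 0 1" by simp
    then show "sphere (0 :: complex^'n) 1 \<noteq> {}" by blast
    show "continuous_on (sphere 0 1) (\<lambda>x. x \<bullet> (M *v x))"
      by (intro continuous_on_inner continuous_on_id
          linear_continuous_on matrix_vector_mul_bounded_linear)
  qed
  then obtain u where u: "norm u = 1"
    and max: "\<And>x. norm x = 1 \<Longrightarrow> x \<bullet> (M *v x) \<le> u \<bullet> (M *v u)"
    by auto
  define l where "l = u \<bullet> (M *v u)"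
  have le: "x \<bullet> (M *v x) \<le> l * (x \<bullet> x)" for x
  proof (cases "x = 0")
    case False
    have "(x /\<^sub>R norm x) \<bullet> (M *v (x /\<^sub>R norm x)) \<le> l"
      unfolding l_def using False by (intro max) simp
    then have "(x \<bullet> (M *v x)) / (norm x * norm x) \<le> l"
      by (simp add: matrix_vector_scaleR_right field_simps)
    then show ?thesis
      using False by (simp add: field_simps dot_square_norm power2_eq_square)
  qed simp
  have "psd (l *\<^sub>R mat 1 - M)"
    using M le by (simp add: psd_iff_inner hermitian_intros matrix_vector_algebra inner_diff_right)
  moreover have "u \<bullet> ((l *\<^sub>R mat 1 - M) *v u) = 0"
    using u by (simp add: matrix_vector_algebra inner_diff_right dot_square_norm l_def[symmetric])
  ultimately have "(l *\<^sub>R mat 1 - M) *v u = 0"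
    by (rule psd_mult_eq_0)
  then have "M *v u = l *\<^sub>R u"
    by (simp add: matrix_vector_algebra)
  with u le show ?thesis by (intro that)
qed

text \<open>Here \<open>V\<close> is the absolute value of \<open>H\<close>. A positive top
  eigenvalue \<open>l\<close> of \<open>H - V\<close>, with unit eigenvector \<open>u\<close>, would
  give \<open>l = - 2 * (u \<bullet> (V *v u))\<close>, which is at most 0. The lemma yields both
  uniqueness of square roots and the upper bound property of \<open>mat_vee\<close>.\<close>

lemma psd_diff_of_squares_eq:
  assumes V: "psd V" and H: "hermitian H" and eq: "V ** V = H ** H"
  shows "psd (V - H)"
proof -
  note hV = psd_hermitian[OF V]
  obtain u l where u: "norm u = 1" "(H - V) *v u = l *\<^sub>R u"
    and le: "\<And>x. x \<bullet> ((H - V) *v x) \<le> l * (x \<bullet> x)"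
    by (rule hermitian_max_eigenvector[OF hermitian_diff[OF H hV]]) blast
  have "l \<le> 0"
  proof (rule ccontr)
    assume "\<not> l \<le> 0"
    \<comment> \<open>tested on the eigenvector, this identity forces \<open>u \<bullet> V u = - (u \<bullet> H u)\<close>\<close>
    have "V ** (H - V) + (H - V) ** H = 0"
      by (simp add: matrix_algebra eq)
    then have "u \<bullet> ((V ** (H - V) + (H - V) ** H) *v u) = 0"
      by simp
    then have "u \<bullet> (V *v ((H - V) *v u)) + u \<bullet> ((H - V) *v (H *v u)) = 0"
      by (simp add: matrix_vector_mult_add_rdistrib matrix_vector_mul_assoc inner_add_right)
    then have "l * (u \<bullet> (V *v u)) + l * (u \<bullet> (H *v u)) = 0"
      by (simp add: hermitian_inner[OF hermitian_diff[OF H hV]] u matrix_vector_scaleR_right)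
    then have 1: "u \<bullet> (H *v u) = - (u \<bullet> (V *v u))"
      using \<open>\<not> l \<le> 0\<close> by (simp add: distrib_left[symmetric])
    have "u \<bullet> ((H - V) *v u) = l"
      using u by (simp add: dot_square_norm)
    then have "u \<bullet> (H *v u) - u \<bullet> (V *v u) = l"
      by (simp add: matrix_vector_algebra inner_diff_right)
    with 1 psd_inner_nonneg[OF V, of u] \<open>\<not> l \<le> 0\<close> show False by simp
  qed
  have "x \<bullet> ((V - H) *v x) \<ge> 0" for x
  proof -
    have "x \<bullet> ((H - V) *v x) \<le> 0"
      using le[of x] \<open>l \<le> 0\<close> by (smt (verit) mult_nonpos_nonneg inner_ge_zero)
    then show ?thesis by (simp add: matrix_vector_algebra inner_diff_right)
  qed
  then show ?thesis using hV H by (simp add: psd_iff_inner hermitian_diff)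
qed

section \<open>Uniqueness of square roots and pseudoinverses\<close>

lemma inner_eq_0_imp_matrix_eq_0:
  fixes M :: "complex^'n^'n"
  assumes "hermitian M" "\<And>x. x \<bullet> (M *v x) = 0"
  shows "M = 0"
proof -
  have "psd M" using assms by (simp add: psd_iff_inner)
  then have "M *v x = 0" for x using assms(2) by (rule psd_mult_eq_0)
  then show ?thesis by (simp add: matrix_eq)
qed

lemma psd_square_inject:
  assumes "psd R" "psd T" "R ** R = T ** T"
  shows "R = T"
proof -
  have "psd (R - T)" "psd (T - R)"
    using assms by (auto intro: psd_diff_of_squares_eq simp: psd_hermitian)
  then have "x \<bullet> ((R - T) *v x) = 0" for x
    using psd_inner_nonneg[of "R - T" x] psd_inner_nonneg[of "T - R" x]
    by (simp add: matrix_vector_algebra inner_diff_right)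
  then show ?thesis
    using inner_eq_0_imp_matrix_eq_0[of "R - T"] \<open>psd (R - T)\<close> by (simp add: psd_hermitian)
qed

lemma psd_sqrt_eqI: "psd R \<Longrightarrow> R ** R = M \<Longrightarrow> psd_sqrt M = R"
  unfolding psd_sqrt_def by (rule the_equality) (auto intro: psd_square_inject)

text \<open>For two candidates \<open>N\<close> and \<open>K\<close>, \<open>N ** M\<close> equals
  \<open>N ** M ** (K ** M)\<close>; taking adjoints reverses this product and collapses it to
  \<open>K ** M\<close>. The same works on the other side, and then \<open>K = K ** M ** K\<close>
  turns into \<open>N\<close>.\<close>

lemma pinv_eqI:
  assumes "is_moore_penrose M N"
  shows "pinv M = N"
  unfolding pinv_def
proof (rule the_equality[of "is_moore_penrose M", OF assms])
  fix K assume K: "is_moore_penrose M K"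
  have NM: "N ** M = K ** M"
  proof -
    have "N ** M = N ** M ** (K ** M)" using K by (metis is_moore_penrose_def matrix_mul_assoc)
    also have "\<dots> = ctranspose (N ** M) ** ctranspose (K ** M)"
      using assms K by (simp add: is_moore_penrose_def matrix_mul_assoc)
    also have "\<dots> = ctranspose (K ** (M ** N ** M))"
      by (simp add: ctranspose_mult matrix_mul_assoc)
    also have "\<dots> = K ** M" using assms K by (simp add: is_moore_penrose_def)
    finally show ?thesis .
  qed
  have MN: "M ** N = M ** K"
  proof -
    have "M ** N = M ** K ** (M ** N)" using K by (metis is_moore_penrose_def matrix_mul_assoc)
    also have "\<dots> = ctranspose (M ** K) ** ctranspose (M ** N)"
      using assms K by (simp add: is_moore_penrose_def matrix_mul_assoc)
    also have "\<dots> = ctranspose ((M ** N ** M) ** K)"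
      by (simp add: ctranspose_mult matrix_mul_assoc)
    also have "\<dots> = M ** K" using assms K by (simp add: is_moore_penrose_def)
    finally show ?thesis .
  qed
  have "K = K ** M ** K" using K by (simp add: is_moore_penrose_def)
  also have "\<dots> = N ** M ** K" by (simp add: NM)
  also have "\<dots> = N ** M ** N" by (simp add: matrix_mul_assoc[symmetric] MN)
  also have "\<dots> = N" using assms by (simp add: is_moore_penrose_def)
  finally show "K = N" .
qed

section \<open>Square roots and pseudoinverses\<close>

text \<open>The matrix \<open>u u^*\<close>; for a unit vector it is the orthogonal projection onto
  the complex line through \<open>u\<close>, not merely the real one.\<close>

definition outer :: "complex^'n \<Rightarrow> complex^'n^'n" where
  "outer u = (\<chi> i j. u $ i * cnj (u $ j))"

lemma hermitian_outer: "hermitian (outer u)"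
  by (simp add: hermitian_def ctranspose_def outer_def vec_eq_iff)

lemma sum_cnj_mult_self: "(\<Sum>k\<in>UNIV. cnj (u $ k) * u $ k) = complex_of_real ((norm u)\<^sup>2)"
proof -
  have "(\<Sum>k\<in>UNIV. cnj (u $ k) * u $ k) = (\<Sum>k\<in>UNIV. complex_of_real ((norm (u $ k))\<^sup>2))"
    by (intro sum.cong refl) (simp add: complex_norm_square mult.commute del: of_real_power)
  also have "\<dots> = complex_of_real ((norm u)\<^sup>2)"
    by (simp add: norm_vec_def L2_set_def sum_nonneg del: of_real_power)
  finally show ?thesis .
qed

lemma outer_idem:
  assumes "norm u = 1"
  shows "outer u ** outer u = outer u"
proof -
  have 1: "(\<Sum>k\<in>UNIV. cnj (u $ k) * u $ k) = 1"
    using assms by (simp add: sum_cnj_mult_self)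
  have "(\<Sum>k\<in>UNIV. u $ i * cnj (u $ k) * (u $ k * cnj (u $ j))) = u $ i * cnj (u $ j)" for i j
    using arg_cong[OF 1, of "\<lambda>s. u $ i * s * cnj (u $ j)"]
    by (simp add: sum_distrib_left sum_distrib_right mult.assoc)
  then show ?thesis
    by (simp add: outer_def vec_eq_iff matrix_matrix_mult_def)
qed

lemma psd_outer: "norm u = 1 \<Longrightarrow> psd (outer u)"
  using psd_square[OF hermitian_outer, of u] by (simp add: outer_idem)

lemma matrix_mult_outer: "M *v u = l *\<^sub>R u \<Longrightarrow> M ** outer u = l *\<^sub>R outer u"
proof -
  assume "M *v u = l *\<^sub>R u"
  then have "(\<Sum>k\<in>UNIV. M $ i $ k * u $ k) = l *\<^sub>R u $ i" for i
    by (simp add: vec_eq_iff matrix_vector_mult_def)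
  from arg_cong[OF this, of "\<lambda>s. s * cnj (u $ j)" for j] show ?thesis
    by (simp add: outer_def vec_eq_iff matrix_matrix_mult_def sum_distrib_right mult.assoc)
qed

lemma outer_mult_matrix:
  assumes "hermitian M" "M *v u = l *\<^sub>R u"
  shows "outer u ** M = l *\<^sub>R outer u"
  using arg_cong[OF matrix_mult_outer[OF assms(2)], of ctranspose] assms(1) hermitian_outer[of u]
  by (simp add: ctranspose_mult hermitian_def)

lemma outer_mult_self: "norm u = 1 \<Longrightarrow> outer u *v u = u"
  by (simp add: outer_def vec_eq_iff matrix_vector_mult_def mult.assoc sum_distrib_left[symmetric]
      sum_cnj_mult_self)

text \<open>Subtracting \<open>l u u\<^sup>*\<close> for a top eigenpair \<open>(l, u)\<close> enlarges the kernel.\<close>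

lemma psd_deflation_induct [consumes 1, case_names zero add]:
  fixes M :: "complex^'n^'n"
  assumes "psd M" and zero: "P 0"
    and add: "\<And>M u l. psd M \<Longrightarrow> M *v u = 0 \<Longrightarrow> norm u = 1 \<Longrightarrow> 0 < l \<Longrightarrow> P M
      \<Longrightarrow> P (M + l *\<^sub>R outer u)"
  shows "P M"
  using \<open>psd M\<close>
\<comment> \<open>The induction measure is the real codimension of the kernel.\<close>
proof (induction "DIM(complex^'n) - dim {x. M *v x = 0}" arbitrary: M rule: less_induct)
  case less
  have M: "hermitian M" by (rule psd_hermitian[OF less.prems])
  obtain u l where u: "norm u = 1" "M *v u = l *\<^sub>R u"
    and le: "\<And>x. x \<bullet> (M *v x) \<le> l * (x \<bullet> x)"
    by (rule hermitian_max_eigenvector[OF M]) blast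
  have l: "l = u \<bullet> (M *v u)" using u by (simp add: dot_square_norm)
  then have "l \<ge> 0" using less.prems by (simp add: psd_inner_nonneg)
  show ?case
  proof (cases "l = 0")
    case True
    then have "x \<bullet> (M *v x) = 0" for x
      using le[of x] psd_inner_nonneg[OF less.prems, of x] by simp
    then have "M = 0" by (rule inner_eq_0_imp_matrix_eq_0[OF M])
    with zero show ?thesis by simp
  next
    case False
    with \<open>l \<ge> 0\<close> have "l > 0" by simp
    define M' where "M' = M - l *\<^sub>R outer u"
    \<comment> \<open>Writing the deflated matrix as a congruence of \<open>M\<close> shows that it
      is still positive semi-definite.\<close>
    have "M' = (mat 1 - outer u) ** M ** (mat 1 - outer u)"
      by (simp add: M'_def matrix_algebra matrix_mult_outer[OF u(2)] outer_mult_matrix[OF M u(2)]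
          outer_idem[OF u(1)])
    then have M': "psd M'"
      using less.prems by (simp add: psd_congruence hermitian_intros hermitian_outer)
    have M'u: "M' *v u = 0"
      by (simp add: M'_def matrix_vector_algebra u outer_mult_self[OF u(1)])
    \<comment> \<open>The old kernel is orthogonal to \<open>u\<close>, so it survives the
      deflation, while \<open>u\<close> itself is new in the kernel.\<close>
    have outer_ker: "outer u *v x = 0" if "M *v x = 0" for x
    proof -
      have "l *\<^sub>R (outer u *v x) = (outer u ** M) *v x"
        by (simp add: outer_mult_matrix[OF M u(2)] matrix_vector_scaleR_left)
      also have "\<dots> = 0" by (simp add: matrix_vector_mul_assoc[symmetric] that)
      finally show ?thesis using False by simp
    qed
    have "u \<notin> {x. M *v x = 0}"
      using u False by auto
    moreover have "{x. M *v x = 0} \<subseteq> {x. M' *v x = 0}"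
      by (auto simp: M'_def matrix_vector_algebra outer_ker)
    ultimately have "{x. M *v x = 0} \<subset> {x. M' *v x = 0}"
      using M'u by blast
    moreover have sub: "subspace {x. N *v x = 0}" for N :: "complex^'n^'n"
      by (auto simp: subspace_def matrix_vector_algebra)
    ultimately have "dim {x. M *v x = 0} < dim {x. M' *v x = 0}"
      by (intro dim_psubset) (simp add: span_eq_iff[THEN iffD2, OF sub])
    moreover have "dim {x. M' *v x = 0} \<le> DIM(complex^'n)"
      by (rule dim_subset_UNIV)
    ultimately have "P M'"
      by (intro less.hyps M') linarith
    with add[OF M' M'u u(1) \<open>l > 0\<close>] show ?thesis by (simp add: M'_def)
  qed
qed

text \<open>\<open>T\<close> is the pseudoinverse of \<open>R\<close>, so that \<open>T ** T\<close> is the one of \<open>M\<close>.\<close>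

lemma psd_sqrt_pinv_exist:
  fixes M :: "complex^'n^'n"
  assumes "psd M"
  shows "\<exists>R T. psd R \<and> psd T \<and> R ** R = M \<and> R ** T = T ** R \<and> R ** T ** R = R \<and> T ** R ** T = T"
  using assms
proof (induction M rule: psd_deflation_induct)
  case zero
  have "psd (0 :: complex^'n^'n)" by (simp add: psd_iff_inner hermitian_def ctranspose_def vec_eq_iff)
  then show ?case by (intro exI[of _ 0]) simp
next
  case (add M u l)
  then obtain R T where R: "psd R" "R ** R = M" and T: "psd T"
    and RT: "R ** T = T ** R" "R ** T ** R = R" "T ** R ** T = T"
    by blast
  note hR = psd_hermitian[OF R(1)] and hT = psd_hermitian[OF T]
  have "(R *v u) \<bullet> (R *v u) = u \<bullet> (M *v u)"
    by (simp add: R(2)[symmetric] matrix_vector_algebra hermitian_inner[OF hR, of u])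
  \<comment> \<open>The zero vector is written as \<open>0 *\<^sub>R u\<close> so that the
    eigenvector lemmas for \<open>outer\<close> apply with eigenvalue 0; all cross terms below then
    vanish.\<close>
  then have Ru: "R *v u = 0 *\<^sub>R u" using add by simp
  \<comment> \<open>Since \<open>T = T ** T ** R\<close>, the kernel of \<open>R\<close> is
    contained in that of \<open>T\<close>.\<close>
  have "T *v u = (T ** (R ** T)) *v u" by (simp add: matrix_mul_assoc RT(3))
  also have "\<dots> = T *v (T *v (R *v u))" by (simp add: matrix_vector_mul_assoc RT(1))
  finally have Tu: "T *v u = 0 *\<^sub>R u" using Ru by simp
  note 0 = matrix_mult_outer[OF Ru] matrix_mult_outer[OF Tu]
    outer_mult_matrix[OF hR Ru] outer_mult_matrix[OF hT Tu] outer_idem[OF \<open>norm u = 1\<close>]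
  define r where "r = sqrt l"
  have r: "r > 0" "r * r = l" using add by (simp_all add: r_def)
  let ?R = "R + r *\<^sub>R outer u" and ?T = "T + inverse r *\<^sub>R outer u"
  have prod: "?R ** ?R = M + l *\<^sub>R outer u" "?R ** ?T = R ** T + outer u" "?T ** ?R = R ** T + outer u"
    using r by (simp_all add: matrix_algebra 0 R(2) RT(1))
  moreover have "(R ** T + outer u) ** ?R = ?R"
    by (simp add: matrix_add_ldistrib matrix_add_rdistrib matrix_scaleR_right matrix_mul_assoc[symmetric] 0)
      (simp add: matrix_mul_assoc RT(2))
  moreover have "(R ** T + outer u) ** ?T = ?T"
    unfolding RT(1)
    by (simp add: matrix_add_ldistrib matrix_add_rdistrib matrix_scaleR_right matrix_mul_assoc[symmetric] 0)
      (simp add: matrix_mul_assoc RT(3))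
  ultimately show ?case
    using r R(1) T add
    by (intro exI[of _ ?R] exI[of _ ?T] conjI) (simp_all add: psd_add psd_scaleR psd_outer)
qed

text \<open>Identifies the pair \<open>R\<close>, \<open>T\<close> with the defined roots;
  \<open>R ** T\<close> is the orthogonal projection onto the range of \<open>M\<close>.\<close>

lemma psd_sqrt_pinvE:
  assumes "psd M"
  obtains R T where "psd R" "psd T" "psd_sqrt M = R" "psd_sqrt (pinv M) = T" "pinv M = T ** T"
    "R ** R = M" "R ** T = T ** R" "M ** pinv M = R ** T" "pinv M ** M = R ** T"
    "R ** T ** R = R" "T ** R ** T = T"
proof -
  obtain R T where R: "psd R" "R ** R = M" and T: "psd T"
    and RT: "R ** T = T ** R" "R ** T ** R = R" "T ** R ** T = T"
    using psd_sqrt_pinv_exist[OF assms] by blast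
  have 1: "M ** (T ** T) = R ** T"
    by (metis R(2) RT(1,2) matrix_mul_assoc)
  have 2: "T ** T ** M = R ** T"
    by (metis R(2) RT(1,3) matrix_mul_assoc)
  have "ctranspose (R ** T) = R ** T"
    using psd_hermitian[OF R(1)] psd_hermitian[OF T] RT(1) by (simp add: ctranspose_mult hermitian_def)
  then have "is_moore_penrose M (T ** T)"
    by (metis 1 2 R(2) RT(2,3) is_moore_penrose_def matrix_mul_assoc)
  then have 3: "pinv M = T ** T" by (rule pinv_eqI)
  show ?thesis
    using R T RT 1 2 3 by (intro that[of R T]) (auto intro: psd_sqrt_eqI)
qed

lemma psd_psd_sqrt: "psd M \<Longrightarrow> psd (psd_sqrt M)"
  and psd_sqrt_square: "psd M \<Longrightarrow> psd_sqrt M ** psd_sqrt M = M"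
  using psd_sqrt_pinvE[of M] by metis+

lemma psd_pinv: "psd M \<Longrightarrow> psd (pinv M)"
  using psd_sqrt_pinvE[of M] by (metis psd_square psd_hermitian)

lemma is_moore_penrose_pinv:
  assumes "psd M"
  shows "is_moore_penrose M (pinv M)"
proof -
  obtain R T where R: "psd R" "R ** R = M" "pinv M = T ** T" and T: "psd T"
    and RT: "R ** T = T ** R" "R ** T ** R = R" "T ** R ** T = T"
      "M ** pinv M = R ** T" "pinv M ** M = R ** T"
    using psd_sqrt_pinvE[OF assms] by metis
  have "ctranspose (R ** T) = R ** T"
    using psd_hermitian[OF R(1)] psd_hermitian[OF T] RT(1) by (simp add: ctranspose_mult hermitian_def)
  moreover have "R ** T ** M = M" by (metis R(2) RT(2) matrix_mul_assoc)
  moreover have "R ** T ** pinv M = pinv M" by (metis R(3) RT(1,3) matrix_mul_assoc)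
  ultimately show ?thesis by (simp add: is_moore_penrose_def RT(4,5))
qed

lemma psd_sqrt_scaleR:
  assumes "psd M" "0 \<le> c"
  shows "psd_sqrt (c *\<^sub>R M) = sqrt c *\<^sub>R psd_sqrt M"
  using assms by (intro psd_sqrt_eqI)
    (auto simp: psd_scaleR psd_psd_sqrt matrix_algebra psd_sqrt_square)

lemma pinv_scaleR:
  assumes "psd M" "0 < c"
  shows "pinv (c *\<^sub>R M) = inverse c *\<^sub>R pinv M"
  using is_moore_penrose_pinv[OF assms(1)] assms(2)
  by (intro pinv_eqI) (simp add: is_moore_penrose_def matrix_algebra)

section \<open>Parallel sums\<close>

text \<open>Both forms are nonnegative, so the kernel of \<open>P + Q\<close> lies in the kernel of
  \<open>P\<close>, and \<open>x - (pinv (P + Q) ** (P + Q)) *v x\<close> is in the former. The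
  second identity is the adjoint of the first.\<close>

lemma psd_add_pinv_absorb:
  assumes P: "psd P" and Q: "psd Q"
  shows "P ** pinv (P + Q) ** (P + Q) = P" "(P + Q) ** pinv (P + Q) ** P = P"
proof -
  let ?S = "P + Q" and ?N = "pinv (P + Q)"
  have S: "psd ?S" using P Q by (rule psd_add)
  have mp: "is_moore_penrose ?S ?N" using S by (rule is_moore_penrose_pinv)
  have "P *v (x - (?N ** ?S) *v x) = 0" for x
  proof -
    let ?y = "x - (?N ** ?S) *v x"
    have "?S *v ?y = ?S *v x - (?S ** ?N ** ?S) *v x"
      by (simp only: matrix_vector_mult_diff_distrib matrix_vector_mul_assoc matrix_mul_assoc)
    then have "?S *v ?y = 0" using mp by (simp add: is_moore_penrose_def)
    then have "?y \<bullet> (P *v ?y) + ?y \<bullet> (Q *v ?y) = 0"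
      by (simp add: matrix_vector_mult_add_rdistrib inner_add_right[symmetric])
    then have "?y \<bullet> (P *v ?y) = 0"
      using psd_inner_nonneg[OF P, of ?y] psd_inner_nonneg[OF Q, of ?y] by simp
    then show ?thesis by (rule psd_mult_eq_0[OF P])
  qed
  then have "P *v x = (P ** ?N ** ?S) *v x" for x
    by (simp add: matrix_vector_mult_diff_distrib matrix_vector_mul_assoc matrix_mul_assoc)
  then show 1: "P ** ?N ** ?S = P" by (simp add: matrix_eq)
  have "P = ctranspose (P ** ?N ** ?S)" using 1 psd_hermitian[OF P] by (simp add: hermitian_def)
  also have "\<dots> = ?S ** ?N ** P"
    using psd_hermitian[OF P] psd_hermitian[OF psd_pinv[OF S]] psd_hermitian[OF S]
    by (simp add: hermitian_def ctranspose_mult matrix_mul_assoc del: ctranspose_simps)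
  finally show "?S ** ?N ** P = P" ..
qed

lemma parallel_sum_commute:
  assumes "psd P" "psd Q"
  shows "parallel_sum Q P = parallel_sum P Q"
proof -
  have "P ** pinv (P + Q) ** P + P ** pinv (P + Q) ** Q = P ** pinv (P + Q) ** P + Q ** pinv (P + Q) ** P"
    using psd_add_pinv_absorb[OF assms] by (simp add: matrix_algebra)
  then show ?thesis by (simp add: parallel_sum_def add.commute)
qed

lemma parallel_sum_eq:
  assumes "psd P" "psd Q"
  shows "parallel_sum P Q = Q - Q ** pinv (P + Q) ** Q"
  using psd_add_pinv_absorb(2)[OF assms(2,1)]
  by (simp add: parallel_sum_def matrix_algebra add.commute[of Q P] eq_diff_eq)

lemma hermitian_parallel_sum: "psd P \<Longrightarrow> psd Q \<Longrightarrow> hermitian (parallel_sum P Q)"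
  by (simp add: parallel_sum_eq hermitian_intros psd_hermitian psd_pinv psd_add)

lemma parallel_sum_scaleR:
  assumes "psd P" "psd Q" "0 < c"
  shows "parallel_sum (c *\<^sub>R P) (c *\<^sub>R Q) = c *\<^sub>R parallel_sum P Q"
  using assms by (simp add: parallel_sum_def scaleR_add_right[symmetric] pinv_scaleR psd_add matrix_algebra)

text \<open>Completing the square in \<open>y\<close>: the leading form is \<open>P + Q\<close>, and
  absorption makes \<open>pinv (P + Q) *v (Q *v x)\<close> a solution of the stationarity equation
  \<open>(P + Q) *v y = Q *v x\<close>.\<close>

lemma parallel_sum_variation:
  fixes P Q :: "complex^'n^'n" and x y :: "complex^'n"
  assumes P: "psd P" and Q: "psd Q"
  defines "d \<equiv> y - pinv (P + Q) *v (Q *v x)"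
  shows "y \<bullet> (P *v y) + (x - y) \<bullet> (Q *v (x - y)) = x \<bullet> (parallel_sum P Q *v x) + d \<bullet> ((P + Q) *v d)"
proof -
  let ?S = "P + Q"
  define y0 where "y0 = pinv ?S *v (Q *v x)"
  note hS = psd_hermitian[OF psd_add[OF P Q]]
  have y: "y = y0 + d" by (simp add: d_def y0_def)
  have Sy0: "?S *v y0 = Q *v x"
    using psd_add_pinv_absorb(2)[OF Q P]
    by (simp add: y0_def matrix_vector_mul_assoc matrix_mul_assoc add.commute)
  have "y \<bullet> (P *v y) + (x - y) \<bullet> (Q *v (x - y)) = y \<bullet> (?S *v y) - 2 * (y \<bullet> (Q *v x)) + x \<bullet> (Q *v x)"
    using hermitian_inner[OF psd_hermitian[OF Q], of x y]
    by (simp add: matrix_vector_algebra inner_diff_left inner_diff_right inner_add_right inner_commute)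
  moreover have "y \<bullet> (?S *v y) = y0 \<bullet> (Q *v x) + 2 * (d \<bullet> (Q *v x)) + d \<bullet> (?S *v d)"
    using hermitian_inner[OF hS, of y0 d]
    unfolding y matrix_vector_right_distrib Sy0 inner_add_left inner_add_right
    by (simp add: inner_commute)
  moreover have "y \<bullet> (Q *v x) = y0 \<bullet> (Q *v x) + d \<bullet> (Q *v x)"
    by (simp add: y inner_add_left)
  moreover have "x \<bullet> (parallel_sum P Q *v x) = x \<bullet> (Q *v x) - y0 \<bullet> (Q *v x)"
    using hermitian_inner[OF psd_hermitian[OF Q], of x y0]
    by (simp add: parallel_sum_eq[OF P Q] matrix_vector_mult_diff_rdistrib inner_diff_right
        y0_def matrix_vector_mul_assoc[symmetric] inner_commute)
  ultimately show ?thesis by simp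
qed

lemma parallel_sum_inner_le:
  assumes "psd P" "psd Q"
  shows "x \<bullet> (parallel_sum P Q *v x) \<le> y \<bullet> (P *v y) + (x - y) \<bullet> (Q *v (x - y))"
  unfolding parallel_sum_variation[OF assms, of y x] le_add_same_cancel1
  by (rule psd_inner_nonneg[OF psd_add[OF assms]])

lemma parallel_sum_attained:
  assumes "psd P" "psd Q" and y: "y = pinv (P + Q) *v (Q *v x)"
  shows "x \<bullet> (parallel_sum P Q *v x) = y \<bullet> (P *v y) + (x - y) \<bullet> (Q *v (x - y))"
  using parallel_sum_variation[OF assms(1,2), of y x] by (simp add: y[symmetric])

text \<open>The minimiser for the enlarged pair is a competitor for \<open>A\<close> and
  \<open>B\<close>; the two values differ by forms of \<open>X\<close> and \<open>Y\<close>.\<close>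

lemma psd_parallel_sum_increment:
  assumes "psd A" "psd B" "psd X" "psd Y"
  shows "psd (parallel_sum (A + X) (B + Y) - parallel_sum A B)"
  unfolding psd_iff_inner
proof (intro conjI allI)
  fix x
  define y where "y = pinv ((A + X) + (B + Y)) *v ((B + Y) *v x)"
  have "x \<bullet> (parallel_sum (A + X) (B + Y) *v x) = y \<bullet> ((A + X) *v y) + (x - y) \<bullet> ((B + Y) *v (x - y))"
    by (rule parallel_sum_attained[OF psd_add[OF assms(1,3)] psd_add[OF assms(2,4)] y_def])
  moreover have "x \<bullet> (parallel_sum A B *v x) \<le> y \<bullet> (A *v y) + (x - y) \<bullet> (B *v (x - y))"
    by (rule parallel_sum_inner_le[OF assms(1,2)])
  ultimately show "0 \<le> x \<bullet> ((parallel_sum (A + X) (B + Y) - parallel_sum A B) *v x)"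
    using psd_inner_nonneg[OF assms(3), of y] psd_inner_nonneg[OF assms(4), of "x - y"]
    by (simp add: matrix_vector_mult_add_rdistrib matrix_vector_mult_diff_rdistrib
        inner_add_right inner_diff_right)
qed (simp add: assms hermitian_intros hermitian_parallel_sum psd_add)

section \<open>The upper bound of two matrices\<close>

text \<open>
  \<open>R ** H ** R = (P - Q) / 2\<close> for \<open>R = psd_sqrt (P + Q)\<close>, so \<open>mat_vee P Q = (P + Q) / 2 + R ** \<bar>H\<bar> ** R\<close>
  is an analogue of \<open>max p q = (p + q) / 2 + \<bar>p - q\<bar> / 2\<close>.
\<close>

lemma W_mat_eq_square:
  assumes P: "psd P" and Q: "psd Q"
  defines "H \<equiv> (1 / 2) *\<^sub>R (psd_sqrt (pinv (P + Q)) ** (P - Q) ** psd_sqrt (pinv (P + Q)))"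
  shows "W_mat P Q = H ** H"
proof -
  let ?N = "pinv (P + Q)"
  define T where "T = psd_sqrt ?N"
  have TT: "?N = T ** T" using P Q by (simp add: T_def psd_sqrt_square psd_pinv psd_add)
  have QP: "Q ** ?N ** P = P ** ?N ** Q"
    using parallel_sum_commute[OF P Q] by (simp add: parallel_sum_def add.commute)
  \<comment> \<open>Absorption expresses all four products of the expansion through
    \<open>P\<close>, \<open>Q\<close> and \<open>P ** ?N ** Q\<close>.\<close>
  have "(P - Q) ** ?N ** (P - Q) = P + Q - 4 *\<^sub>R (P ** ?N ** Q)"
  proof -
    have "P ** ?N ** P = P - P ** ?N ** Q"
      using parallel_sum_eq[OF Q P] QP by (simp add: parallel_sum_def add.commute)
    moreover have "Q ** ?N ** Q = Q - P ** ?N ** Q"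
      using parallel_sum_eq[OF P Q] by (simp add: parallel_sum_def)
    ultimately show ?thesis
      by (simp add: matrix_algebra QP) (simp add: vec_eq_iff scaleR_conv_of_real)
  qed
  then have "(P + Q) /\<^sub>R 4 - parallel_sum P Q = (1 / 4) *\<^sub>R ((P - Q) ** ?N ** (P - Q))"
    by (simp add: parallel_sum_def scaleR_diff_right)
  then show ?thesis
    unfolding W_mat_def H_def T_def[symmetric] unfolding TT
    by (simp add: matrix_scaleR_left matrix_scaleR_right matrix_mul_assoc)
qed

text \<open>The root \<open>V\<close> of \<open>W_mat P Q\<close> is the absolute value of
  \<open>H\<close>, hence dominates \<open>H\<close> and its negative; congruence with
  \<open>R\<close> carries this over to \<open>(P - Q) / 2\<close> and its negative.\<close>

lemma mat_vee_upper:
  assumes P: "psd P" and Q: "psd Q"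
  shows "psd (mat_vee P Q - P)" "psd (mat_vee P Q - Q)"
proof -
  let ?S = "P + Q"
  have S: "psd ?S" using P Q by (rule psd_add)
  obtain R T where R: "psd R" "psd_sqrt ?S = R" and T: "psd T" "psd_sqrt (pinv ?S) = T"
    and RT: "R ** T = T ** R" "?S ** pinv ?S = R ** T" "pinv ?S ** ?S = R ** T"
    using psd_sqrt_pinvE[OF S] by metis
  define H where "H = (1 / 2) *\<^sub>R (T ** (P - Q) ** T)"
  define V where "V = psd_sqrt (W_mat P Q)"
  have H: "hermitian H"
    unfolding H_def using P Q T by (intro hermitian_intros psd_hermitian)
  have W: "W_mat P Q = H ** H"
    using W_mat_eq_square[OF P Q] by (simp add: H_def T)
  have V: "psd V" "V ** V = H ** H"
    unfolding V_def W using psd_square[OF H] by (auto intro: psd_psd_sqrt psd_sqrt_square)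
  have "psd (V - H)" by (rule psd_diff_of_squares_eq[OF V(1) H V(2)])
  have "((-1) *\<^sub>R H) ** ((-1) *\<^sub>R H) = H ** H"
    unfolding matrix_scaleR_left matrix_scaleR_right by simp
  then have "psd (V - (-1) *\<^sub>R H)"
    using V by (intro psd_diff_of_squares_eq hermitian_scaleR H) simp_all
  \<comment> \<open>The projection \<open>R ** T\<close> fixes \<open>P\<close> and
    \<open>Q\<close>, so sandwiching \<open>H\<close> by \<open>R\<close> undoes the sandwich by
    \<open>T\<close>.\<close>
  have "R ** T ** P = P" "P ** (R ** T) = P"
    using psd_add_pinv_absorb[OF P Q] RT(2,3) by (simp_all add: matrix_mul_assoc[symmetric])
  moreover have "R ** T ** Q = Q" "Q ** (R ** T) = Q"
    using psd_add_pinv_absorb[OF Q P, unfolded add.commute[of Q P]] RT(2,3)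
    by (simp_all add: matrix_mul_assoc[symmetric])
  ultimately have J: "R ** T ** (P - Q) = P - Q" "(P - Q) ** (R ** T) = P - Q"
    by (simp_all only: matrix_diff_ldistrib matrix_diff_rdistrib)
  have "R ** H ** R = (1 / 2) *\<^sub>R ((R ** T) ** (P - Q) ** (T ** R))"
    by (simp only: H_def matrix_scaleR_left matrix_scaleR_right matrix_mul_assoc)
  also have "\<dots> = (1 / 2) *\<^sub>R (P - Q)" by (simp only: J RT(1)[symmetric])
  finally have RHR: "R ** H ** R = (1 / 2) *\<^sub>R (P - Q)" .
  have vee: "mat_vee P Q = (1 / 2) *\<^sub>R (P + Q) + R ** V ** R"
    by (simp add: mat_vee_def R V_def)
  have "mat_vee P Q - P = R ** (V - H) ** R"
    unfolding matrix_diff_ldistrib matrix_diff_rdistrib RHR vee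
    by (simp add: vec_eq_iff) (simp add: scaleR_conv_of_real field_simps)
  then show "psd (mat_vee P Q - P)"
    using \<open>psd (V - H)\<close> R(1) by (simp add: psd_congruence psd_hermitian)
  have "mat_vee P Q - Q = R ** (V - (-1) *\<^sub>R H) ** R"
    unfolding matrix_diff_ldistrib matrix_diff_rdistrib matrix_scaleR_left matrix_scaleR_right RHR vee
    by (simp add: vec_eq_iff) (simp add: scaleR_conv_of_real field_simps)
  then show "psd (mat_vee P Q - Q)"
    using \<open>psd (V - (-1) *\<^sub>R H)\<close> R(1) by (simp only: psd_congruence psd_hermitian)
qed

text \<open>\<open>W_mat\<close> is homogeneous of degree 0, and the two outer roots contribute
  \<open>sqrt c\<close> each.\<close>

lemma mat_vee_scaleR:
  assumes P: "psd P" and Q: "psd Q" and c: "0 < c"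
  shows "mat_vee (c *\<^sub>R P) (c *\<^sub>R Q) = c *\<^sub>R mat_vee P Q"
proof -
  have S: "psd (P + Q)" using P Q by (rule psd_add)
  let ?T = "psd_sqrt (pinv (P + Q))" and ?D = "(P + Q) /\<^sub>R 4 - parallel_sum P Q"
  have T: "psd_sqrt (pinv (c *\<^sub>R P + c *\<^sub>R Q)) = sqrt (inverse c) *\<^sub>R ?T"
    using c S by (simp only: scaleR_add_right[symmetric] pinv_scaleR)
      (intro psd_sqrt_scaleR psd_pinv, auto)
  have D: "(c *\<^sub>R P + c *\<^sub>R Q) /\<^sub>R 4 - parallel_sum (c *\<^sub>R P) (c *\<^sub>R Q) = c *\<^sub>R ?D"
    unfolding parallel_sum_scaleR[OF P Q c] by (simp add: vec_eq_iff algebra_simps)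
  have "sqrt (inverse c) * (c * sqrt (inverse c)) = 1"
    using c by (simp add: mult.left_commute)
  then have W: "W_mat (c *\<^sub>R P) (c *\<^sub>R Q) = W_mat P Q"
    unfolding W_mat_def T D matrix_scaleR_left matrix_scaleR_right scaleR_scaleR
    by (simp only: mult.assoc mult.commute mult.left_commute scaleR_one)
  have R: "psd_sqrt (c *\<^sub>R P + c *\<^sub>R Q) = sqrt c *\<^sub>R psd_sqrt (P + Q)"
    using c S by (simp add: scaleR_add_right[symmetric] psd_sqrt_scaleR)
  show ?thesis
    unfolding mat_vee_def W R matrix_scaleR_left matrix_scaleR_right scaleR_scaleR
    using c by (simp add: scaleR_add_right)
qed

section \<open>Norm bounds\<close>

lemma spectral_norm_nonneg: "0 \<le> spectral_norm M"
  by (simp add: spectral_norm_def onorm_pos_le matrix_vector_mul_bounded_linear)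

lemma norm_mult_le_spectral_norm: "norm (M *v x) \<le> spectral_norm M * norm x"
  by (simp add: spectral_norm_def onorm matrix_vector_mul_bounded_linear)

lemma spectral_norm_scaleR: "spectral_norm (c *\<^sub>R M) = \<bar>c\<bar> * spectral_norm M"
  by (simp add: spectral_norm_def matrix_vector_scaleR_left onorm_scaleR matrix_vector_mul_bounded_linear)

lemma inner_le_spectral_norm: "x \<bullet> (M *v x) \<le> spectral_norm M * (x \<bullet> x)"
proof -
  have "x \<bullet> (M *v x) \<le> norm x * (spectral_norm M * norm x)"
    by (rule order_trans[OF norm_cauchy_schwarz mult_left_mono[OF norm_mult_le_spectral_norm norm_ge_zero]])
  then show ?thesis by (simp add: dot_square_norm power2_eq_square algebra_simps)
qed

text \<open>With \<open>R\<close> the root of \<open>E\<close>, the squared norm of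
  \<open>E *v x\<close> is the form of \<open>E\<close> at \<open>R *v x\<close>, and the squared
  norm of \<open>R *v x\<close> is the form at \<open>x\<close>; the bound is applied to
  each.\<close>

lemma psd_spectral_norm_le:
  assumes E: "psd E" and c: "0 \<le> c" and le: "\<And>x. x \<bullet> (E *v x) \<le> c * (x \<bullet> x)"
  shows "spectral_norm E \<le> c"
  unfolding spectral_norm_def
proof (rule onorm_le)
  fix x
  define R where "R = psd_sqrt E"
  have R: "hermitian R" "R ** R = E"
    using E by (simp_all add: R_def psd_psd_sqrt psd_hermitian psd_sqrt_square)
  have Rx: "(R *v y) \<bullet> (R *v y) = y \<bullet> (E *v y)" for y
    using hermitian_inner[OF R(1), of y "R *v y"] by (simp add: R(2)[symmetric] matrix_vector_mul_assoc[symmetric])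
  have "(norm (E *v x))\<^sup>2 = (R *v (R *v x)) \<bullet> (R *v (R *v x))"
    by (simp add: dot_square_norm matrix_vector_mul_assoc R)
  also have "\<dots> \<le> c * ((R *v x) \<bullet> (R *v x))"
    unfolding Rx[of "R *v x"] by (rule le)
  also have "\<dots> \<le> c * (c * (x \<bullet> x))"
    unfolding Rx[of x] using le c by (intro mult_left_mono)
  also have "\<dots> = (c * norm x)\<^sup>2"
    by (simp add: dot_square_norm power2_eq_square)
  finally show "norm (E *v x) \<le> c * norm x"
    by (rule power2_le_imp_le) (simp add: c)
qed

lemma parallel_sum_increment_inner_le:
  fixes A B X Y :: "complex^'n^'n" and \<alpha> \<beta> z :: real
  defines "s \<equiv> spectral_norm (A + B)"
    and "n \<equiv> spectral_norm (pinv (A + B) ** (\<beta> *\<^sub>R A - \<alpha> *\<^sub>R B))"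
  assumes A: "psd A" and B: "psd B" and X: "psd X" and Y: "psd Y"
    and pos: "0 < \<alpha>" "0 < \<beta>" "0 \<le> z"
    and Xz: "\<And>v. v \<bullet> (X *v v) \<le> \<alpha> * z * (v \<bullet> v)"
    and Yz: "\<And>v. v \<bullet> (Y *v v) \<le> \<beta> * z * (v \<bullet> v)"
  shows "x \<bullet> ((parallel_sum (A + X) (B + Y) - parallel_sum A B) *v x)
    \<le> (n\<^sup>2 * s / ((\<alpha> + \<beta>) * s + (\<alpha> + \<beta>)\<^sup>2 * z) + \<alpha> * \<beta> / (\<alpha> + \<beta>)) * z * (x \<bullet> x)"
proof -
  let ?S = "A + B" and ?N = "pinv (A + B)"
  have S: "psd ?S" using A B by (rule psd_add)
  have mp: "is_moore_penrose ?S ?N" using S by (rule is_moore_penrose_pinv)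
  define g where "g = \<alpha> + \<beta>"
  have g: "g > 0" using pos by (simp add: g_def)
  have s: "s \<ge> 0" by (simp add: s_def spectral_norm_nonneg)
  define y0 where "y0 = ?N *v (B *v x)"
  \<comment> \<open>The full displacement from the minimiser for \<open>A : B\<close> to the one for
    the scalar pair \<open>\<alpha> z I\<close>, \<open>\<beta> z I\<close>.\<close>
  define d0 where "d0 = (\<beta> / g) *\<^sub>R x - y0"
  define e where "e = (1 / g) *\<^sub>R ((?N ** (\<beta> *\<^sub>R A - \<alpha> *\<^sub>R B)) *v x)"
  \<comment> \<open>Thus \<open>e\<close>, whose length is controlled by \<open>n\<close>, is the
    orthogonal projection of \<open>d0\<close> onto the range of \<open>A + B\<close>.\<close>
  have e: "e = (?N ** ?S) *v d0"
  proof -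
    have "(?N ** ?S) *v y0 = (?N ** ?S ** ?N) *v (B *v x)"
      by (simp only: y0_def matrix_vector_mul_assoc matrix_mul_assoc)
    also have "\<dots> = y0" using mp by (simp add: is_moore_penrose_def y0_def)
    finally have "(?N ** ?S) *v y0 = y0" .
    then have "g *\<^sub>R ((?N ** ?S) *v d0) = \<beta> *\<^sub>R ((?N ** ?S) *v x) - g *\<^sub>R y0"
      using g by (simp add: d0_def matrix_vector_mult_diff_distrib matrix_vector_scaleR_right scaleR_diff_right)
    also have "\<dots> = (?N ** (\<beta> *\<^sub>R A - \<alpha> *\<^sub>R B)) *v x"
      by (simp add: y0_def g_def matrix_vector_algebra matrix_add_ldistrib matrix_diff_ldistrib
          matrix_scaleR_right scaleR_add_left scaleR_add_right)
    also have "\<dots> = g *\<^sub>R e" using g by (simp add: e_def)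
    finally show ?thesis using g by simp
  qed
  have Se: "?S *v e = ?S *v d0"
    using mp by (simp add: e matrix_vector_mul_assoc matrix_mul_assoc is_moore_penrose_def)
  \<comment> \<open>\<open>\<lambda>k. k\<^sup>2 * s + z * g * (1 - k)\<^sup>2\<close> is minimal at \<open>k = c\<close>; if \<open>s = z = 0\<close> then \<open>c = 0\<close> by
    division by zero, which is harmless\<close>
  define c where "c = z * g / (s + z * g)"
  \<comment> \<open>Equivalently \<open>y = y0 + (d0 - e) + c *\<^sub>R e\<close>: the kernel
    component of the move is made in full, the range component in proportion
    \<open>c\<close>.\<close>
  define y where "y = (\<beta> / g) *\<^sub>R x - (1 - c) *\<^sub>R e"
  define w where "w = x - y"
  have w: "w = (\<alpha> / g) *\<^sub>R x + (1 - c) *\<^sub>R e"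
  proof -
    have "(\<alpha> / g) *\<^sub>R x + (\<beta> / g) *\<^sub>R x = x"
      using g by (simp add: scaleR_add_left[symmetric] add_divide_distrib[symmetric] g_def)
    then show ?thesis by (simp add: w_def y_def algebra_simps)
  qed
  \<comment> \<open>The minimal value is the parallel sum of the numbers \<open>s\<close> and
    \<open>z * g\<close>.\<close>
  have opt: "c\<^sup>2 * s + z * g * (1 - c)\<^sup>2 = s * z * g / (s + z * g)"
  proof (cases "s + z * g = 0")
    case True
    then show ?thesis using s pos g by (simp add: c_def add_nonneg_eq_0_iff)
  next
    case False
    then have "1 - c = s / (s + z * g)" by (simp add: c_def field_simps)
    then have "(c\<^sup>2 * s + z * g * (1 - c)\<^sup>2) = (s * z * g) * (s + z * g) / (s + z * g)\<^sup>2"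
      by (simp add: c_def power_divide add_divide_distrib[symmetric]) (simp add: power2_eq_square algebra_simps)
    then show ?thesis using False by (simp add: power2_eq_square)
  qed
  have AB: "y \<bullet> (A *v y) + w \<bullet> (B *v w) \<le> x \<bullet> (parallel_sum A B *v x) + c\<^sup>2 * s * (e \<bullet> e)"
  proof -
    \<comment> \<open>\<open>d\<close> and \<open>c *\<^sub>R e\<close> differ by the kernel vector
      \<open>d0 - e\<close>, so only the factor \<open>c\<close> enters the cost.\<close>
    define d where "d = y - y0"
    have d: "d = d0 - (1 - c) *\<^sub>R e" by (simp add: d_def d0_def y_def)
    then have Sd: "?S *v d = c *\<^sub>R (?S *v e)"
      by (simp only: matrix_vector_mult_diff_distrib matrix_vector_scaleR_right Se)
        (simp add: algebra_simps)
    have "d \<bullet> (?S *v e) = c * (e \<bullet> (?S *v e))"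
      using hermitian_inner[OF psd_hermitian[OF S], of d e] Sd by (simp add: inner_commute)
    then have "d \<bullet> (?S *v d) = c\<^sup>2 * (e \<bullet> (?S *v e))"
      by (simp add: Sd power2_eq_square)
    also have "\<dots> \<le> c\<^sup>2 * (s * (e \<bullet> e))"
      unfolding s_def by (intro mult_left_mono inner_le_spectral_norm) simp
    finally show ?thesis
      using parallel_sum_variation[OF A B, of y x] by (simp add: w_def d_def y0_def mult.assoc)
  qed
  have XY: "y \<bullet> (X *v y) + w \<bullet> (Y *v w) \<le> z * (\<alpha> * \<beta> / g * (x \<bullet> x) + g * (1 - c)\<^sup>2 * (e \<bullet> e))"
  proof -
    \<comment> \<open>The mixed terms in \<open>x \<bullet> e\<close> cancel because
      \<open>\<alpha> * (\<beta> / g) = \<beta> * (\<alpha> / g)\<close>.\<close>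
    have "\<alpha> * (y \<bullet> y) + \<beta> * (w \<bullet> w) = (\<alpha> * (\<beta> / g)\<^sup>2 + \<beta> * (\<alpha> / g)\<^sup>2) * (x \<bullet> x) + (\<alpha> + \<beta>) * (1 - c)\<^sup>2 * (e \<bullet> e)"
      unfolding w y_def using g
      by (simp add: inner_diff_left inner_diff_right inner_add_left inner_add_right inner_commute[of e x]
          power2_eq_square) (simp add: field_simps)
    also have "\<alpha> * (\<beta> / g)\<^sup>2 + \<beta> * (\<alpha> / g)\<^sup>2 = \<alpha> * \<beta> / g"
    proof -
      have "\<alpha> * (\<beta> / g)\<^sup>2 + \<beta> * (\<alpha> / g)\<^sup>2 = \<alpha> * \<beta> * g / g\<^sup>2"
        by (simp add: power_divide add_divide_distrib[symmetric])
          (simp add: g_def power2_eq_square algebra_simps)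
      then show ?thesis using g by (simp add: power2_eq_square)
    qed
    finally have "z * (\<alpha> * (y \<bullet> y) + \<beta> * (w \<bullet> w)) = z * (\<alpha> * \<beta> / g * (x \<bullet> x) + g * (1 - c)\<^sup>2 * (e \<bullet> e))"
      by (simp only: g_def)
    then show ?thesis using Xz[of y] Yz[of w] by (simp add: algebra_simps)
  qed
  have ee: "e \<bullet> e \<le> n\<^sup>2 * (x \<bullet> x) / g\<^sup>2"
  proof -
    have "norm e \<le> n * norm x / g"
      using norm_mult_le_spectral_norm[of "?N ** (\<beta> *\<^sub>R A - \<alpha> *\<^sub>R B)" x] g
      by (simp add: e_def n_def divide_right_mono)
    then have "(norm e)\<^sup>2 \<le> (n * norm x / g)\<^sup>2" by (intro power_mono) auto
    then show ?thesis by (simp add: dot_square_norm power_divide power_mult_distrib)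
  qed
  have "x \<bullet> (parallel_sum (A + X) (B + Y) *v x) \<le> y \<bullet> ((A + X) *v y) + w \<bullet> ((B + Y) *v w)"
    unfolding w_def by (intro parallel_sum_inner_le psd_add A B X Y)
  then have "x \<bullet> ((parallel_sum (A + X) (B + Y) - parallel_sum A B) *v x)
      \<le> (y \<bullet> (A *v y) + w \<bullet> (B *v w) - x \<bullet> (parallel_sum A B *v x)) + (y \<bullet> (X *v y) + w \<bullet> (Y *v w))"
    by (simp add: matrix_vector_mult_add_rdistrib matrix_vector_mult_diff_rdistrib
        inner_add_right inner_diff_right)
  also have "\<dots> \<le> c\<^sup>2 * s * (e \<bullet> e) + z * (\<alpha> * \<beta> / g * (x \<bullet> x) + g * (1 - c)\<^sup>2 * (e \<bullet> e))"
    using AB XY by linarith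
  also have "\<dots> = s * z * g / (s + z * g) * (e \<bullet> e) + \<alpha> * \<beta> / g * z * (x \<bullet> x)"
    unfolding opt[symmetric] by (simp add: algebra_simps)
  also have "\<dots> \<le> s * z * g / (s + z * g) * (n\<^sup>2 * (x \<bullet> x) / g\<^sup>2) + \<alpha> * \<beta> / g * z * (x \<bullet> x)"
    using s pos g by (intro add_right_mono mult_left_mono ee) simp
  also have "s * z * g / (s + z * g) * (n\<^sup>2 * (x \<bullet> x) / g\<^sup>2) = n\<^sup>2 * s / (g * s + g\<^sup>2 * z) * z * (x \<bullet> x)"
  proof -
    have "g * s + g\<^sup>2 * z = g * (s + z * g)" by (simp add: power2_eq_square algebra_simps)
    then show ?thesis using g by (simp add: power2_eq_square mult_ac)
  qed
  finally show ?thesis unfolding g_def by (simp only: distrib_right)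
qed

section \<open>Bounds through the norm of \<open>Z\<close>, and the three infima\<close>

lemma mat_vee_spectral_norm_bounds:
  assumes "psd X" "psd Y" "0 < \<alpha>" "0 < \<beta>"
  defines "z \<equiv> spectral_norm (mat_vee (X /\<^sub>R \<alpha>) (Y /\<^sub>R \<beta>))"
  shows "v \<bullet> (X *v v) \<le> \<alpha> * z * (v \<bullet> v)" "v \<bullet> (Y *v v) \<le> \<beta> * z * (v \<bullet> v)"
proof -
  let ?Z = "mat_vee (X /\<^sub>R \<alpha>) (Y /\<^sub>R \<beta>)"
  have XY: "psd (X /\<^sub>R \<alpha>)" "psd (Y /\<^sub>R \<beta>)" using assms by (simp_all add: psd_scaleR)
  have Z: "v \<bullet> (?Z *v v) \<le> z * (v \<bullet> v)" unfolding z_def by (rule inner_le_spectral_norm)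
  have "inverse \<alpha> * (v \<bullet> (X *v v)) \<le> v \<bullet> (?Z *v v)"
    using psd_inner_nonneg[OF mat_vee_upper(1)[OF XY], of v]
    by (simp add: matrix_vector_mult_diff_rdistrib inner_diff_right matrix_vector_scaleR_left)
  with Z have "inverse \<alpha> * (v \<bullet> (X *v v)) \<le> z * (v \<bullet> v)" by linarith
  then show "v \<bullet> (X *v v) \<le> \<alpha> * z * (v \<bullet> v)" using assms by (simp add: field_simps)
  have "inverse \<beta> * (v \<bullet> (Y *v v)) \<le> v \<bullet> (?Z *v v)"
    using psd_inner_nonneg[OF mat_vee_upper(2)[OF XY], of v]
    by (simp add: matrix_vector_mult_diff_rdistrib inner_diff_right matrix_vector_scaleR_left)
  with Z have "inverse \<beta> * (v \<bullet> (Y *v v)) \<le> z * (v \<bullet> v)" by linarith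
  then show "v \<bullet> (Y *v v) \<le> \<beta> * z * (v \<bullet> v)" using assms by (simp add: field_simps)
qed

lemma mat_vee_divide:
  assumes "psd X" "psd Y" "0 < \<alpha>" "0 < \<beta>"
  shows "mat_vee (X /\<^sub>R \<alpha>) (Y /\<^sub>R \<beta>) = (1 / \<alpha>) *\<^sub>R mat_vee X (Y /\<^sub>R (\<beta> / \<alpha>))"
proof -
  have "Y /\<^sub>R \<beta> = (1 / \<alpha>) *\<^sub>R (Y /\<^sub>R (\<beta> / \<alpha>))" using assms by (simp add: inverse_eq_divide)
  moreover have "X /\<^sub>R \<alpha> = (1 / \<alpha>) *\<^sub>R X" by (simp add: inverse_eq_divide)
  ultimately show ?thesis
    using assms by (simp only: mat_vee_scaleR psd_scaleR divide_pos_pos zero_less_one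
        less_imp_le positive_imp_inverse_positive)
qed

theorem theorem3p5:
  fixes A B X Y :: "complex^'n^'n"
  assumes "psd A" and "psd B" and "psd X" and "psd Y"
  shows
    "let E = parallel_sum (A + X) (B + Y) - parallel_sum A B;
         Z = (\<lambda>\<alpha> \<beta> :: real. mat_vee (X /\<^sub>R \<alpha>) (Y /\<^sub>R \<beta>));
         f = (\<lambda>t :: real. 1 / (1 + t)
                * ((spectral_norm (pinv (A + B) ** (t *\<^sub>R A - B)))\<^sup>2 + t)
                * spectral_norm (mat_vee X (Y /\<^sub>R t)))
     in
       (\<forall>\<alpha> > 0. \<forall>\<beta> > 0. Z \<alpha> \<beta> = (1 / \<alpha>) *\<^sub>R mat_vee X (Y /\<^sub>R (\<beta> / \<alpha>))) \<and>
       spectral_norm E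
         \<le> (INF (\<alpha>, \<beta>) \<in> {0<..} \<times> {0<..}.
              ((spectral_norm (pinv (A + B) ** (\<beta> *\<^sub>R A - \<alpha> *\<^sub>R B)))\<^sup>2 * spectral_norm (A + B)
                 / ((\<alpha> + \<beta>) * spectral_norm (A + B) + (\<alpha> + \<beta>)\<^sup>2 * spectral_norm (Z \<alpha> \<beta>))
               + \<alpha> * \<beta> / (\<alpha> + \<beta>))
              * spectral_norm (Z \<alpha> \<beta>)) \<and>
       (INF (\<alpha>, \<beta>) \<in> {0<..} \<times> {0<..}.
              ((spectral_norm (pinv (A + B) ** (\<beta> *\<^sub>R A - \<alpha> *\<^sub>R B)))\<^sup>2 * spectral_norm (A + B)
                 / ((\<alpha> + \<beta>) * spectral_norm (A + B) + (\<alpha> + \<beta>)\<^sup>2 * spectral_norm (Z \<alpha> \<beta>))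
               + \<alpha> * \<beta> / (\<alpha> + \<beta>))
              * spectral_norm (Z \<alpha> \<beta>))
         \<le> (INF (\<alpha>, \<beta>) \<in> {0<..} \<times> {0<..}.
              1 / (\<alpha> + \<beta>)
              * ((spectral_norm (pinv (A + B) ** (\<beta> *\<^sub>R A - \<alpha> *\<^sub>R B)))\<^sup>2 + \<alpha> * \<beta>)
              * spectral_norm (Z \<alpha> \<beta>)) \<and>
       (INF (\<alpha>, \<beta>) \<in> {0<..} \<times> {0<..}.
              1 / (\<alpha> + \<beta>)
              * ((spectral_norm (pinv (A + B) ** (\<beta> *\<^sub>R A - \<alpha> *\<^sub>R B)))\<^sup>2 + \<alpha> * \<beta>)
              * spectral_norm (Z \<alpha> \<beta>))
         = (INF t \<in> {0<..}. f t)"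
proof -
  define E where "E = parallel_sum (A + X) (B + Y) - parallel_sum A B"
  define Z where "Z = (\<lambda>\<alpha> \<beta> :: real. mat_vee (X /\<^sub>R \<alpha>) (Y /\<^sub>R \<beta>))"
  define s where "s = spectral_norm (A + B)"
  define n where "n = (\<lambda>\<alpha> \<beta> :: real. spectral_norm (pinv (A + B) ** (\<beta> *\<^sub>R A - \<alpha> *\<^sub>R B)))"
  define z where "z = (\<lambda>\<alpha> \<beta>. spectral_norm (Z \<alpha> \<beta>))"
  define f where "f = (\<lambda>t. 1 / (1 + t) * ((n 1 t)\<^sup>2 + t) * z 1 t)"
  define F where "F = (\<lambda>\<alpha> \<beta>. ((n \<alpha> \<beta>)\<^sup>2 * s / ((\<alpha> + \<beta>) * s + (\<alpha> + \<beta>)\<^sup>2 * z \<alpha> \<beta>) + \<alpha> * \<beta> / (\<alpha> + \<beta>)) * z \<alpha> \<beta>)"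
  define G where "G = (\<lambda>\<alpha> \<beta>. 1 / (\<alpha> + \<beta>) * ((n \<alpha> \<beta>)\<^sup>2 + \<alpha> * \<beta>) * z \<alpha> \<beta>)"
  define I where "I = {0::real<..} \<times> {0::real<..}"
  have I: "I \<noteq> {}" by (auto simp: I_def)
  have nn: "0 \<le> s" "0 \<le> n \<alpha> \<beta>" "0 \<le> z \<alpha> \<beta>" for \<alpha> \<beta>
    by (simp_all add: s_def n_def z_def spectral_norm_nonneg)
  have Z: "Z \<alpha> \<beta> = (1 / \<alpha>) *\<^sub>R mat_vee X (Y /\<^sub>R (\<beta> / \<alpha>))" if "0 < \<alpha>" "0 < \<beta>" for \<alpha> \<beta>
    unfolding Z_def using assms(3,4) that by (rule mat_vee_divide)
  have F_nonneg: "0 \<le> F \<alpha> \<beta>" if "0 < \<alpha>" "0 < \<beta>" for \<alpha> \<beta>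
    using that nn by (simp add: F_def)
  have E_le: "spectral_norm E \<le> F \<alpha> \<beta>" if "0 < \<alpha>" "0 < \<beta>" for \<alpha> \<beta>
  proof (rule psd_spectral_norm_le)
    show "psd E" unfolding E_def using assms by (rule psd_parallel_sum_increment)
    show "0 \<le> F \<alpha> \<beta>" using that by (rule F_nonneg)
    show "x \<bullet> (E *v x) \<le> F \<alpha> \<beta> * (x \<bullet> x)" for x
      unfolding E_def F_def n_def s_def
      using mat_vee_spectral_norm_bounds[OF assms(3,4) that] nn(3)[of \<alpha> \<beta>]
      by (intro parallel_sum_increment_inner_le assms that) (simp_all add: z_def Z_def)
  qed
  have F_le_G: "F \<alpha> \<beta> \<le> G \<alpha> \<beta>" if "0 < \<alpha>" "0 < \<beta>" for \<alpha> \<beta>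
  proof -
    \<comment> \<open>For \<open>s > 0\<close> the nonnegative term with \<open>z\<close> is dropped
      from the denominator; for \<open>s = 0\<close> the numerator vanishes and the left side is
      0.\<close>
    have "(n \<alpha> \<beta>)\<^sup>2 * s / ((\<alpha> + \<beta>) * s + (\<alpha> + \<beta>)\<^sup>2 * z \<alpha> \<beta>) \<le> (n \<alpha> \<beta>)\<^sup>2 / (\<alpha> + \<beta>)"
    proof (cases "s = 0")
      case False
      then have "s > 0" using nn by simp
      then have "(n \<alpha> \<beta>)\<^sup>2 * s / ((\<alpha> + \<beta>) * s + (\<alpha> + \<beta>)\<^sup>2 * z \<alpha> \<beta>) \<le> (n \<alpha> \<beta>)\<^sup>2 * s / ((\<alpha> + \<beta>) * s)"
        using that nn by (intro divide_left_mono mult_pos_pos add_pos_nonneg) auto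
      then show ?thesis using False by simp
    qed (use that in simp)
    then show ?thesis
      unfolding F_def G_def using nn(3)
      by (intro mult_right_mono) (simp_all add: add_divide_distrib)
  qed
  \<comment> \<open>In the pair of parameters \<open>n\<close> has degree 1 and \<open>z\<close>
    degree -1, so \<open>G\<close> has degree 0 and depends on the ratio only.\<close>
  have G_eq: "G \<alpha> \<beta> = f (\<beta> / \<alpha>)" if "0 < \<alpha>" "0 < \<beta>" for \<alpha> \<beta>
  proof -
    have "\<beta> *\<^sub>R A - \<alpha> *\<^sub>R B = \<alpha> *\<^sub>R ((\<beta> / \<alpha>) *\<^sub>R A - 1 *\<^sub>R B)"
      using that by (simp add: scaleR_diff_right)
    then have "n \<alpha> \<beta> = \<alpha> * n 1 (\<beta> / \<alpha>)"
      using that by (simp only: n_def matrix_scaleR_right spectral_norm_scaleR abs_of_pos)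
    moreover have "z \<alpha> \<beta> = z 1 (\<beta> / \<alpha>) / \<alpha>"
      using that Z[OF that] Z[of 1 "\<beta> / \<alpha>"] by (simp add: z_def spectral_norm_scaleR)
    moreover have "1 / (\<alpha> + \<beta>) * ((\<alpha> * p)\<^sup>2 + \<alpha> * \<beta>) * (q / \<alpha>) = 1 / (1 + \<beta> / \<alpha>) * (p\<^sup>2 + \<beta> / \<alpha>) * q" for p q
      using that by (simp add: field_simps power2_eq_square)
    ultimately show ?thesis by (simp only: G_def f_def)
  qed
  have "spectral_norm E \<le> (INF (\<alpha>, \<beta>) \<in> I. F \<alpha> \<beta>)"
    by (rule cINF_greatest[OF I]) (auto simp: I_def E_le)
  moreover have "(INF (\<alpha>, \<beta>) \<in> I. F \<alpha> \<beta>) \<le> (INF (\<alpha>, \<beta>) \<in> I. G \<alpha> \<beta>)"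
  proof (rule cINF_mono[OF I])
    \<comment> \<open>Infima of reals are monotone only for families bounded below; nonnegativity
      provides this.\<close>
    show "bdd_below ((\<lambda>(\<alpha>, \<beta>). F \<alpha> \<beta>) ` I)"
      by (rule bdd_belowI[of _ 0]) (auto simp: I_def F_nonneg)
    show "\<exists>p\<in>I. (case p of (\<alpha>, \<beta>) \<Rightarrow> F \<alpha> \<beta>) \<le> (case q of (\<alpha>, \<beta>) \<Rightarrow> G \<alpha> \<beta>)" if "q \<in> I" for q
      using that by (intro bexI[of _ q]) (auto simp: I_def F_le_G)
  qed
  moreover have "(INF (\<alpha>, \<beta>) \<in> I. G \<alpha> \<beta>) = (INF t \<in> {0<..}. f t)"
  proof -
    \<comment> \<open>The two infima range over the same set of values; the pair
      \<open>(1, t)\<close> realises \<open>f t\<close>.\<close>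
    have "(\<lambda>(\<alpha>, \<beta>). G \<alpha> \<beta>) ` I = f ` {0<..}"
    proof (intro equalityI subsetI)
      fix r assume "r \<in> (\<lambda>(\<alpha>, \<beta>). G \<alpha> \<beta>) ` I"
      then show "r \<in> f ` {0<..}" by (auto simp: I_def G_eq)
    next
      fix r assume "r \<in> f ` {0<..}"
      then obtain t where "0 < t" "r = f t" by auto
      then have "(1, t) \<in> I" "r = (case (1, t) of (\<alpha>, \<beta>) \<Rightarrow> G \<alpha> \<beta>)"
        by (simp_all add: I_def G_eq)
      then show "r \<in> (\<lambda>(\<alpha>, \<beta>). G \<alpha> \<beta>) ` I" by blast
    qed
    then show ?thesis by simp
  qed
  moreover have "\<forall>\<alpha>>0. \<forall>\<beta>>0. Z \<alpha> \<beta> = (1 / \<alpha>) *\<^sub>R mat_vee X (Y /\<^sub>R (\<beta> / \<alpha>))"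
    using Z by blast
  moreover have "f = (\<lambda>t. 1 / (1 + t) * ((spectral_norm (pinv (A + B) ** (t *\<^sub>R A - B)))\<^sup>2 + t)
      * spectral_norm (mat_vee X (Y /\<^sub>R t)))"
    by (simp add: f_def n_def z_def Z_def)
  ultimately show ?thesis
    unfolding Let_def E_def F_def G_def I_def z_def n_def s_def Z_def by (simp only:)
qed

end
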